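(* Let $(A,\bullet)$ be a mock-Lie algebra and $r\in A\otimes A$. Let $\Delta:A\to A\otimes A$ be defined by $\Delta(x)=(L(x)\otimes\mathrm{id}-\mathrm{id}\otimes L(x))r$, and define a bilinear map $\diamond:A^*\otimes A^*\to A^*$ by $$\langle\xi\diamond\eta,x\rangle=\langle\Delta^*(\xi\otimes\eta),x\rangle=\langle\xi\otimes\eta,\Delta(x)\rangle\qquad(\xi,\eta\in A^*,\ x\in A).$$ Then $(A^*,\diamond)$ is a mock-Lie algebra if and only if the following conditions hold for all $x\in A$: (i) $(L(x)\otimes\mathrm{id}-\mathrm{id}\otimes L(x))(r+\tau(r))=0$; (ii) $Q(x)[[r,r]]=0$, where $Q(x)=L(x)\otimes\mathrm{id}\otimes\mathrm{id}+\mathrm{id}\otimes L(x)\otimes\mathrm{id}+\mathrm{id}\otimes\mathrm{id}\otimes L(x)$ and $[[r,r]]=r_{12}\bullet r_{13}+r_{13}\bullet r_{23}-r_{12}\bullet r_{23}$. Under these conditions, $(A,A^* )$ is a coboundary mock-Lie bialgebra.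
   Context: All vector spaces are finite-dimensional over a field $\mathbb{K}$ of characteristic zero. A mock-Lie algebra $(A,\bullet)$ is a vector space with a bilinear product that is commutative and satisfies $x\bullet(y\bullet z)+y\bullet(z\bullet x)+z\bullet(x\bullet y)=0$. $L(x)y=x\bullet y$, and $\tau(u\otimes v)=v\otimes u$. For $r=\sum_i a_i\otimes b_i\in A\otimes A$: $r_{12}\bullet r_{13}=\sum_{i,j}(a_i\bullet a_j)\otimes b_i\otimes b_j$, $r_{13}\bullet r_{23}=\sum_{i,j}a_i\otimes a_j\otimes(b_i\bullet b_j)$, $r_{12}\bullet r_{23}=\sum_{i,j}a_i\otimes(b_i\bullet a_j)\otimes b_j$. A mock-Lie bialgebra structure on $(A,\bullet)$, denoted $(A,\Delta)$ or $(A,A^* )$, is a symmetric linear map $\Delta:A\to A\otimes A$ (i.e. $\tau\circ\Delta=\Delta$) such that $\Delta^*:A^*\otimes A^*\to A^*$ defines a mock-Lie algebra structure on $A^*$ and, for all $x,y\in A$, $$\Delta(x\bullet y)=-(L(x)\otimes\mathrm{id}+\mathrm{id}\otimes L(x))\Delta(y)-(L(y)\otimes\mathrm{id}+\mathrm{id}\otimes L(y))\Delta(x).$$ It is coboundary if there is $r\in A\otimes A$ with $\Delta(x)=(L(x)\otimes\mathrm{id}-\mathrm{id}\otimes L(x))r$ for all $x\in A$. *)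

theory Defs
  imports Main "HOL.Vector_Spaces" "HOL-Library.Function_Algebras"
begin

section \<open>Multilinear maps and the dual space\<close>

definition bilinear_map ::
  "('k::field \<Rightarrow> 'a::ab_group_add \<Rightarrow> 'a) \<Rightarrow> ('k \<Rightarrow> 'w::ab_group_add \<Rightarrow> 'w) \<Rightarrow> ('a \<Rightarrow> 'a \<Rightarrow> 'w) \<Rightarrow> bool"
  where "bilinear_map s s' f \<longleftrightarrow>
    (\<forall>y. Vector_Spaces.linear s s' (\<lambda>x. f x y)) \<and>
    (\<forall>x. Vector_Spaces.linear s s' (\<lambda>y. f x y))"

definition trilinear_map ::
  "('k::field \<Rightarrow> 'a::ab_group_add \<Rightarrow> 'a) \<Rightarrow> ('k \<Rightarrow> 'w::ab_group_add \<Rightarrow> 'w) \<Rightarrow> ('a \<Rightarrow> 'a \<Rightarrow> 'a \<Rightarrow> 'w) \<Rightarrow> bool"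
  where "trilinear_map s s' f \<longleftrightarrow>
    (\<forall>y z. Vector_Spaces.linear s s' (\<lambda>x. f x y z)) \<and>
    (\<forall>x z. Vector_Spaces.linear s s' (\<lambda>y. f x y z)) \<and>
    (\<forall>x y. Vector_Spaces.linear s s' (\<lambda>z. f x y z))"

definition fun_scale :: "'k::times \<Rightarrow> ('i \<Rightarrow> 'k) \<Rightarrow> 'i \<Rightarrow> 'k"
  where "fun_scale c f = (\<lambda>i. c * f i)"

lemma vector_space_fun_scale: "vector_space (fun_scale :: 'k::field \<Rightarrow> ('i \<Rightarrow> 'k) \<Rightarrow> 'i \<Rightarrow> 'k)"
  by unfold_locales (auto simp: fun_scale_def fun_eq_iff algebra_simps)

definition dual_space :: "('k::field \<Rightarrow> 'a::ab_group_add \<Rightarrow> 'a) \<Rightarrow> ('a \<Rightarrow> 'k) set"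
  where "dual_space s = {\<xi>. Vector_Spaces.linear s (*) \<xi>}"


section \<open>Tensor powers of a vector space\<close>

text \<open>
  The tensor product \<open>A \<otimes> A\<close> is realised inside the space of functionals on the bilinear forms
  of \<open>A\<close>: the pure tensor \<open>a \<otimes> b\<close> is evaluation at \<open>(a, b)\<close>, and \<open>A \<otimes> A\<close> is the span of
  the pure tensors. Functions that are not bilinear forms carry no information, so all
  elements are made to vanish on them. The universal property is \<open>tensor_universal\<close> below.
  The same is done for \<open>A \<otimes> A \<otimes> A\<close> with trilinear forms.
\<close>

type_synonym ('k, 'a) tens2 = "('a \<Rightarrow> 'a \<Rightarrow> 'k) \<Rightarrow> 'k"
type_synonym ('k, 'a) tens3 = "('a \<Rightarrow> 'a \<Rightarrow> 'a \<Rightarrow> 'k) \<Rightarrow> 'k"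

definition tensor ::
  "('k::field \<Rightarrow> 'a::ab_group_add \<Rightarrow> 'a) \<Rightarrow> 'a \<Rightarrow> 'a \<Rightarrow> ('k, 'a) tens2"
  where "tensor s a b = (\<lambda>\<beta>. if bilinear_map s (*) \<beta> then \<beta> a b else 0)"

definition tensor3 ::
  "('k::field \<Rightarrow> 'a::ab_group_add \<Rightarrow> 'a) \<Rightarrow> 'a \<Rightarrow> 'a \<Rightarrow> 'a \<Rightarrow> ('k, 'a) tens3"
  where "tensor3 s a b c = (\<lambda>\<gamma>. if trilinear_map s (*) \<gamma> then \<gamma> a b c else 0)"

definition tensor_space ::
  "('k::field \<Rightarrow> 'a::ab_group_add \<Rightarrow> 'a) \<Rightarrow> ('k, 'a) tens2 set"
  where "tensor_space s = module.span fun_scale {tensor s a b | a b. True}"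

definition tensor_map ::
  "('k::field \<Rightarrow> 'a::ab_group_add \<Rightarrow> 'a) \<Rightarrow> ('a \<Rightarrow> 'a) \<Rightarrow> ('a \<Rightarrow> 'a) \<Rightarrow> ('k, 'a) tens2 \<Rightarrow> ('k, 'a) tens2"
  where "tensor_map s f g t =
    (\<lambda>\<beta>. if bilinear_map s (*) \<beta> then t (\<lambda>a b. \<beta> (f a) (g b)) else 0)"

definition tensor_map3 ::
  "('k::field \<Rightarrow> 'a::ab_group_add \<Rightarrow> 'a) \<Rightarrow> ('a \<Rightarrow> 'a) \<Rightarrow> ('a \<Rightarrow> 'a) \<Rightarrow> ('a \<Rightarrow> 'a) \<Rightarrow>
    ('k, 'a) tens3 \<Rightarrow> ('k, 'a) tens3"
  where "tensor_map3 s f g h t =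
    (\<lambda>\<gamma>. if trilinear_map s (*) \<gamma> then t (\<lambda>a b c. \<gamma> (f a) (g b) (h c)) else 0)"

definition tensor_flip ::
  "('k::field \<Rightarrow> 'a::ab_group_add \<Rightarrow> 'a) \<Rightarrow> ('k, 'a) tens2 \<Rightarrow> ('k, 'a) tens2"
  where "tensor_flip s t = (\<lambda>\<beta>. if bilinear_map s (*) \<beta> then t (\<lambda>a b. \<beta> b a) else 0)"

definition tensor_pairing :: "('a \<Rightarrow> 'k::field) \<Rightarrow> ('a \<Rightarrow> 'k) \<Rightarrow> ('k, 'a) tens2 \<Rightarrow> 'k"
  where "tensor_pairing \<xi> \<eta> t = t (\<lambda>a b. \<xi> a * \<eta> b)"

text \<open>
  The products \<open>r\<^sub>1\<^sub>2 \<bullet> r\<^sub>1\<^sub>3\<close>, \<open>r\<^sub>1\<^sub>3 \<bullet> r\<^sub>2\<^sub>3\<close> and \<open>r\<^sub>1\<^sub>2 \<bullet> r\<^sub>2\<^sub>3\<close>, with \<open>(a, b)\<close> and \<open>(c, d)\<close>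
  running through the two copies of \<open>r\<close>; the formulas for \<open>r = (\<Sum>i. a\<^sub>i \<otimes> b\<^sub>i)\<close> are
  \<open>r12_r13_sum\<close>, \<open>r13_r23_sum\<close> and \<open>r12_r23_sum\<close> below.
\<close>

definition r12_r13 ::
  "('k::field \<Rightarrow> 'a::ab_group_add \<Rightarrow> 'a) \<Rightarrow> ('a \<Rightarrow> 'a \<Rightarrow> 'a) \<Rightarrow> ('k, 'a) tens2 \<Rightarrow> ('k, 'a) tens3"
  where "r12_r13 s m r =
    (\<lambda>\<gamma>. if trilinear_map s (*) \<gamma> then r (\<lambda>a b. r (\<lambda>c d. \<gamma> (m a c) b d)) else 0)"

definition r13_r23 ::
  "('k::field \<Rightarrow> 'a::ab_group_add \<Rightarrow> 'a) \<Rightarrow> ('a \<Rightarrow> 'a \<Rightarrow> 'a) \<Rightarrow> ('k, 'a) tens2 \<Rightarrow> ('k, 'a) tens3"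
  where "r13_r23 s m r =
    (\<lambda>\<gamma>. if trilinear_map s (*) \<gamma> then r (\<lambda>a b. r (\<lambda>c d. \<gamma> a c (m b d))) else 0)"

definition r12_r23 ::
  "('k::field \<Rightarrow> 'a::ab_group_add \<Rightarrow> 'a) \<Rightarrow> ('a \<Rightarrow> 'a \<Rightarrow> 'a) \<Rightarrow> ('k, 'a) tens2 \<Rightarrow> ('k, 'a) tens3"
  where "r12_r23 s m r =
    (\<lambda>\<gamma>. if trilinear_map s (*) \<gamma> then r (\<lambda>a b. r (\<lambda>c d. \<gamma> a (m b c) d)) else 0)"

definition rr_bracket ::
  "('k::field \<Rightarrow> 'a::ab_group_add \<Rightarrow> 'a) \<Rightarrow> ('a \<Rightarrow> 'a \<Rightarrow> 'a) \<Rightarrow> ('k, 'a) tens2 \<Rightarrow> ('k, 'a) tens3"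
  where "rr_bracket s m r = r12_r13 s m r + r13_r23 s m r - r12_r23 s m r"

text \<open>With \<open>L(x) = m x\<close>: the operators \<open>L(x) \<otimes> id \<plusminus> id \<otimes> L(x)\<close>, and \<open>Q(x)\<close>\<close>

definition tensor_L_minus ::
  "('k::field \<Rightarrow> 'a::ab_group_add \<Rightarrow> 'a) \<Rightarrow> ('a \<Rightarrow> 'a \<Rightarrow> 'a) \<Rightarrow> 'a \<Rightarrow> ('k, 'a) tens2 \<Rightarrow> ('k, 'a) tens2"
  where "tensor_L_minus s m x t = tensor_map s (m x) id t - tensor_map s id (m x) t"

definition tensor_L_plus ::
  "('k::field \<Rightarrow> 'a::ab_group_add \<Rightarrow> 'a) \<Rightarrow> ('a \<Rightarrow> 'a \<Rightarrow> 'a) \<Rightarrow> 'a \<Rightarrow> ('k, 'a) tens2 \<Rightarrow> ('k, 'a) tens2"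
  where "tensor_L_plus s m x t = tensor_map s (m x) id t + tensor_map s id (m x) t"

definition tensor_Q ::
  "('k::field \<Rightarrow> 'a::ab_group_add \<Rightarrow> 'a) \<Rightarrow> ('a \<Rightarrow> 'a \<Rightarrow> 'a) \<Rightarrow> 'a \<Rightarrow> ('k, 'a) tens3 \<Rightarrow> ('k, 'a) tens3"
  where "tensor_Q s m x t =
    tensor_map3 s (m x) id id t + tensor_map3 s id (m x) id t + tensor_map3 s id id (m x) t"


section \<open>Mock-Lie algebras and bialgebras\<close>

text \<open>
  The carrier \<open>V\<close> is a finite-dimensional subspace of the ambient type, so that the notion applies
  both to \<open>A\<close> (with \<open>V = UNIV\<close>) and to its dual (with \<open>V = dual_space s\<close>).
\<close>

locale mock_lie_algebra = vector_space scale
  for scale :: "'k::field_char_0 \<Rightarrow> 'v::ab_group_add \<Rightarrow> 'v" +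
  fixes V :: "'v set" and mult :: "'v \<Rightarrow> 'v \<Rightarrow> 'v"
  assumes subspace_carrier: "subspace V"
    and finite_dim: "\<exists>B. finite B \<and> span B = V"
    and mult_closed: "\<lbrakk>x \<in> V; y \<in> V\<rbrakk> \<Longrightarrow> mult x y \<in> V"
    and mult_add_left: "\<lbrakk>x \<in> V; y \<in> V; z \<in> V\<rbrakk> \<Longrightarrow> mult (x + y) z = mult x z + mult y z"
    and mult_add_right: "\<lbrakk>x \<in> V; y \<in> V; z \<in> V\<rbrakk> \<Longrightarrow> mult x (y + z) = mult x y + mult x z"
    and mult_scale_left: "\<lbrakk>x \<in> V; y \<in> V\<rbrakk> \<Longrightarrow> mult (scale c x) y = scale c (mult x y)"
    and mult_scale_right: "\<lbrakk>x \<in> V; y \<in> V\<rbrakk> \<Longrightarrow> mult x (scale c y) = scale c (mult x y)"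
    and mult_commute: "\<lbrakk>x \<in> V; y \<in> V\<rbrakk> \<Longrightarrow> mult x y = mult y x"
    and jacobi: "\<lbrakk>x \<in> V; y \<in> V; z \<in> V\<rbrakk> \<Longrightarrow>
      mult x (mult y z) + mult y (mult z x) + mult z (mult x y) = 0"

definition dual_product ::
  "('a \<Rightarrow> ('k::field, 'a) tens2) \<Rightarrow> ('a \<Rightarrow> 'k) \<Rightarrow> ('a \<Rightarrow> 'k) \<Rightarrow> 'a \<Rightarrow> 'k"
  where "dual_product \<Delta> \<xi> \<eta> = (\<lambda>x. tensor_pairing \<xi> \<eta> (\<Delta> x))"

definition mock_lie_bialgebra ::
  "('k::field_char_0 \<Rightarrow> 'a::ab_group_add \<Rightarrow> 'a) \<Rightarrow> ('a \<Rightarrow> 'a \<Rightarrow> 'a) \<Rightarrow> ('a \<Rightarrow> ('k, 'a) tens2) \<Rightarrow> bool"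
  where "mock_lie_bialgebra s m \<Delta> \<longleftrightarrow>
    mock_lie_algebra s UNIV m \<and>
    Vector_Spaces.linear s fun_scale \<Delta> \<and> range \<Delta> \<subseteq> tensor_space s \<and>
    tensor_flip s \<circ> \<Delta> = \<Delta> \<and>
    mock_lie_algebra fun_scale (dual_space s) (dual_product \<Delta>) \<and>
    (\<forall>x y. \<Delta> (m x y) = - tensor_L_plus s m x (\<Delta> y) - tensor_L_plus s m y (\<Delta> x))"

definition coboundary_mock_lie_bialgebra ::
  "('k::field_char_0 \<Rightarrow> 'a::ab_group_add \<Rightarrow> 'a) \<Rightarrow> ('a \<Rightarrow> 'a \<Rightarrow> 'a) \<Rightarrow> ('a \<Rightarrow> ('k, 'a) tens2) \<Rightarrow> bool"
  where "coboundary_mock_lie_bialgebra s m \<Delta> \<longleftrightarrow>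
    mock_lie_bialgebra s m \<Delta> \<and>
    (\<exists>r\<in>tensor_space s. \<forall>x. \<Delta> x = tensor_L_minus s m x r)"


section \<open>Adequacy of the tensor constructions\<close>

lemma vector_space_times: "vector_space ((*) :: 'k::field \<Rightarrow> 'k \<Rightarrow> 'k)"
  by unfold_locales (auto simp: algebra_simps)

lemma sum_fun_apply: "(\<Sum>i\<in>I. f i) x = (\<Sum>i\<in>I. f i x)"
  by (induction I rule: infinite_finite_induct) auto

lemma linear_compose2:
  "\<lbrakk>Vector_Spaces.linear s s f; Vector_Spaces.linear s s' g\<rbrakk> \<Longrightarrow> Vector_Spaces.linear s s' (\<lambda>x. g (f x))"
  using Vector_Spaces.linear_compose[of s s f s' g] by (simp add: o_def)

lemma linear_sum_functions:
  assumes "vector_space s" "\<And>i. i \<in> I \<Longrightarrow> Vector_Spaces.linear s (*) (f i)"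
  shows "Vector_Spaces.linear s (*) (\<lambda>x. \<Sum>i\<in>I. f i x)"
proof -
  interpret vector_space_pair s "(*)"
    using assms(1) vector_space_times by (simp add: vector_space_pair_def)
  show ?thesis
    using assms(2) by (induction I rule: infinite_finite_induct)
      (auto intro: linear_zero linear_compose_add)
qed

lemma bilinear_mapD:
  assumes "bilinear_map s s' f"
  shows "f (x + x') y = f x y + f x' y" "f x (y + y') = f x y + f x y'"
    and "f (s c x) y = s' c (f x y)" "f x (s c y) = s' c (f x y)"
proof -
  interpret l: Vector_Spaces.linear s s' "\<lambda>x. f x y" for y
    using assms by (simp add: bilinear_map_def)
  interpret r: Vector_Spaces.linear s s' "\<lambda>y. f x y" for x
    using assms by (simp add: bilinear_map_def)
  show "f (x + x') y = f x y + f x' y" "f x (y + y') = f x y + f x y'"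
    and "f (s c x) y = s' c (f x y)" "f x (s c y) = s' c (f x y)"
    by (fact l.add r.add l.scale r.scale)+
qed

lemma tensor_space_eq_sums:
  fixes s :: "'k::field \<Rightarrow> 'a::ab_group_add \<Rightarrow> 'a"
  assumes s: "vector_space s"
  shows "r \<in> tensor_space s \<longleftrightarrow> (\<exists>(n::nat) a b. r = (\<Sum>i<n. tensor s (a i) (b i)))"
proof
  interpret s: vector_space s by (fact s)
  interpret fs: vector_space "fun_scale :: 'k \<Rightarrow> (('a \<Rightarrow> 'a \<Rightarrow> 'k) \<Rightarrow> 'k) \<Rightarrow> _"
    by (rule vector_space_fun_scale)
  have sc: "fun_scale c (tensor s a b) = tensor s (s c a) b" for c a b
    by (simp add: fun_scale_def tensor_def fun_eq_iff bilinear_mapD)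
  assume "r \<in> tensor_space s"
  then show "\<exists>(n::nat) a b. r = (\<Sum>i<n. tensor s (a i) (b i))"
    unfolding tensor_space_def
  proof (induction rule: fs.span_induct_alt)
    case base
    show ?case by (rule exI[of _ 0]) simp
  next
    case (step c x y)
    then obtain a0 b0 n a b where x: "x = tensor s a0 b0"
      and y: "y = (\<Sum>i<n::nat. tensor s (a i) (b i))" by auto
    have "fun_scale c x + y =
      (\<Sum>i<Suc n. tensor s ((a(n := s c a0)) i) ((b(n := b0)) i))"
      by (simp add: x y sc add.commute)
    then show ?case by blast
  qed
next
  interpret fs: vector_space "fun_scale :: 'k \<Rightarrow> (('a \<Rightarrow> 'a \<Rightarrow> 'k) \<Rightarrow> 'k) \<Rightarrow> _"
    by (rule vector_space_fun_scale)
  assume "\<exists>(n::nat) a b. r = (\<Sum>i<n. tensor s (a i) (b i))"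
  then show "r \<in> tensor_space s"
    unfolding tensor_space_def by (force intro!: fs.span_sum intro: fs.span_base)
qed

lemma bilinear_tensor:
  fixes s :: "'k::field \<Rightarrow> 'a::ab_group_add \<Rightarrow> 'a"
  assumes "vector_space s"
  shows "bilinear_map s fun_scale (tensor s)"
proof -
  interpret s: vector_space s by (fact assms)
  interpret fs: vector_space "fun_scale :: 'k \<Rightarrow> (('a \<Rightarrow> 'a \<Rightarrow> 'k) \<Rightarrow> 'k) \<Rightarrow> _"
    by (rule vector_space_fun_scale)
  show ?thesis
    unfolding bilinear_map_def
    by (intro conjI allI; unfold_locales)
      (auto simp: fun_scale_def tensor_def fun_eq_iff bilinear_mapD algebra_simps)
qed

text \<open>
  Together with \<open>tensor_space_eq_sums\<close>: every bilinear map \<open>f\<close> induces a well-defined and unique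
  linear map on the tensor product with \<open>a \<otimes> b \<mapsto> f a b\<close>.
\<close>

lemma tensor_universal:
  assumes f: "bilinear_map s s' f"
    and eq: "(\<Sum>i\<in>I. tensor s (a i) (b i)) = (\<Sum>j\<in>J. tensor s (c j) (d j))"
  shows "(\<Sum>i\<in>I. f (a i) (b i)) = (\<Sum>j\<in>J. f (c j) (d j))"
proof -
  interpret f0: Vector_Spaces.linear s s' "\<lambda>x. f x 0"
    using f by (simp add: bilinear_map_def)
  define B where "B = f0.vs2.extend_basis {}"
  have B: "f0.vs2.independent B" "f0.vs2.span B = UNIV"
    unfolding B_def by (simp_all add: f0.vs2.independent_extend_basis f0.vs2.independent_empty)
  have "f0.vs2.representation B (\<Sum>i\<in>I. f (a i) (b i)) e =
      f0.vs2.representation B (\<Sum>j\<in>J. f (c j) (d j)) e" for e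
  proof -
    let ?p = "\<lambda>v. f0.vs2.representation B v e"
    have p: "Vector_Spaces.linear s' (*) ?p"
      by (rule f0.vs2.linear_representation[OF B])
    have comp: "Vector_Spaces.linear s (*) (\<lambda>x. ?p (g x))" if "Vector_Spaces.linear s s' g" for g
      using Vector_Spaces.linear_compose[OF that p] by (simp add: o_def)
    have bil: "bilinear_map s (*) (\<lambda>x y. ?p (f x y))"
      using f by (simp add: bilinear_map_def comp)
    have "(\<Sum>i\<in>I. ?p (f (a i) (b i))) = (\<Sum>j\<in>J. ?p (f (c j) (d j)))"
      using fun_cong[OF eq, of "\<lambda>x y. ?p (f x y)"] bil
      by (simp add: sum_fun_apply tensor_def)
    then show ?thesis
      by (simp only: module_hom.sum[OF p[unfolded linear_iff_module_hom]])
  qed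
  then have eq: "f0.vs2.representation B (\<Sum>i\<in>I. f (a i) (b i)) =
      f0.vs2.representation B (\<Sum>j\<in>J. f (c j) (d j))" by blast
  have rep: "(\<Sum>e | f0.vs2.representation B v e \<noteq> 0. s' (f0.vs2.representation B v e) e) = v" for v
    by (rule f0.vs2.sum_nonzero_representation_eq[OF B(1)]) (simp add: B(2))
  show ?thesis
    using rep[of "\<Sum>i\<in>I. f (a i) (b i)"] rep[of "\<Sum>j\<in>J. f (c j) (d j)"] unfolding eq by simp
qed

lemma tensor3_universal:
  assumes f: "trilinear_map s s' f"
    and eq: "(\<Sum>i\<in>I. tensor3 s (a i) (b i) (a' i)) = (\<Sum>j\<in>J. tensor3 s (c j) (d j) (c' j))"
  shows "(\<Sum>i\<in>I. f (a i) (b i) (a' i)) = (\<Sum>j\<in>J. f (c j) (d j) (c' j))"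
proof -
  interpret f0: Vector_Spaces.linear s s' "\<lambda>x. f x 0 0"
    using f by (simp add: trilinear_map_def)
  define B where "B = f0.vs2.extend_basis {}"
  have B: "f0.vs2.independent B" "f0.vs2.span B = UNIV"
    unfolding B_def by (simp_all add: f0.vs2.independent_extend_basis f0.vs2.independent_empty)
  have "f0.vs2.representation B (\<Sum>i\<in>I. f (a i) (b i) (a' i)) e =
      f0.vs2.representation B (\<Sum>j\<in>J. f (c j) (d j) (c' j)) e" for e
  proof -
    let ?p = "\<lambda>v. f0.vs2.representation B v e"
    have p: "Vector_Spaces.linear s' (*) ?p"
      by (rule f0.vs2.linear_representation[OF B])
    have comp: "Vector_Spaces.linear s (*) (\<lambda>x. ?p (g x))" if "Vector_Spaces.linear s s' g" for g
      using Vector_Spaces.linear_compose[OF that p] by (simp add: o_def)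
    have bil: "trilinear_map s (*) (\<lambda>x y z. ?p (f x y z))"
      using f by (simp add: trilinear_map_def comp)
    have "(\<Sum>i\<in>I. ?p (f (a i) (b i) (a' i))) = (\<Sum>j\<in>J. ?p (f (c j) (d j) (c' j)))"
      using fun_cong[OF eq, of "\<lambda>x y z. ?p (f x y z)"] bil
      by (simp add: sum_fun_apply tensor3_def)
    then show ?thesis
      by (simp only: module_hom.sum[OF p[unfolded linear_iff_module_hom]])
  qed
  then have eq: "f0.vs2.representation B (\<Sum>i\<in>I. f (a i) (b i) (a' i)) =
      f0.vs2.representation B (\<Sum>j\<in>J. f (c j) (d j) (c' j))" by blast
  have rep: "(\<Sum>e | f0.vs2.representation B v e \<noteq> 0. s' (f0.vs2.representation B v e) e) = v" for v
    by (rule f0.vs2.sum_nonzero_representation_eq[OF B(1)]) (simp add: B(2))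
  show ?thesis
    using rep[of "\<Sum>i\<in>I. f (a i) (b i) (a' i)"] rep[of "\<Sum>j\<in>J. f (c j) (d j) (c' j)"] unfolding eq by simp
qed

lemma linear_fun_eval:
  "Vector_Spaces.linear fun_scale (*) (\<lambda>t. t x :: 'k::field)"
  unfolding linear_iff_module_hom module_hom_def module_hom_axioms_def
  using vector_space_fun_scale vector_space_times
  by (auto simp: fun_scale_def module_iff_vector_space)

lemma linear_tensor_map: "Vector_Spaces.linear fun_scale fun_scale (tensor_map s f g)"
  unfolding linear_iff_module_hom module_hom_def module_hom_axioms_def
  using vector_space_fun_scale
  by (auto simp: fun_scale_def module_iff_vector_space tensor_map_def fun_eq_iff)

lemma tensor_map_tensor:
  assumes "Vector_Spaces.linear s s f" "Vector_Spaces.linear s s g"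
  shows "tensor_map s f g (tensor s a b) = tensor s (f a) (g b)"
  using assms linear_compose2[of s]
  by (auto simp: tensor_map_def tensor_def bilinear_map_def fun_eq_iff)

lemma linear_tensor_map3: "Vector_Spaces.linear fun_scale fun_scale (tensor_map3 s f g h)"
  unfolding linear_iff_module_hom module_hom_def module_hom_axioms_def
  using vector_space_fun_scale
  by (auto simp: fun_scale_def module_iff_vector_space tensor_map3_def fun_eq_iff)

lemma tensor_map3_tensor3:
  assumes "Vector_Spaces.linear s s f" "Vector_Spaces.linear s s g" "Vector_Spaces.linear s s h"
  shows "tensor_map3 s f g h (tensor3 s a b c) = tensor3 s (f a) (g b) (h c)"
proof -
  have "trilinear_map s (*) (\<lambda>a b c. \<gamma> (f a) (g b) (h c))" if "trilinear_map s (*) \<gamma>" for \<gamma>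
    using that linear_compose2[OF assms(1), of "(*)" "\<lambda>x. \<gamma> x _ _"]
      linear_compose2[OF assms(2), of "(*)" "\<lambda>y. \<gamma> _ y _"]
      linear_compose2[OF assms(3), of "(*)" "\<lambda>z. \<gamma> _ _ z"]
    unfolding trilinear_map_def by blast
  then show ?thesis
    by (auto simp: tensor_map3_def tensor3_def fun_eq_iff)
qed

lemma linear_tensor_flip: "Vector_Spaces.linear fun_scale fun_scale (tensor_flip s)"
  unfolding linear_iff_module_hom module_hom_def module_hom_axioms_def
  using vector_space_fun_scale
  by (auto simp: fun_scale_def module_iff_vector_space tensor_flip_def fun_eq_iff)

lemma tensor_flip_tensor: "tensor_flip s (tensor s a b) = tensor s b a"
  by (auto simp: tensor_flip_def tensor_def bilinear_map_def fun_eq_iff)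

lemma linear_tensor_pairing: "Vector_Spaces.linear fun_scale (*) (tensor_pairing \<xi> \<eta>)"
  unfolding tensor_pairing_def by (rule linear_fun_eval)

lemma bilinear_mult_forms:
  assumes "\<xi> \<in> dual_space s" "\<eta> \<in> dual_space s"
  shows "bilinear_map s (*) (\<lambda>a b. \<xi> a * \<eta> b)"
  using assms unfolding bilinear_map_def dual_space_def linear_iff_module_hom module_hom_def module_hom_axioms_def
  by (auto simp: algebra_simps)

lemma tensor_pairing_tensor:
  assumes "\<xi> \<in> dual_space s" "\<eta> \<in> dual_space s"
  shows "tensor_pairing \<xi> \<eta> (tensor s a b) = \<xi> a * \<eta> b"
  using bilinear_mult_forms[OF assms] by (simp add: tensor_pairing_def tensor_def)

context
  fixes s :: "'k::field \<Rightarrow> 'a::ab_group_add \<Rightarrow> 'a" and m :: "'a \<Rightarrow> 'a \<Rightarrow> 'a"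
    and I :: "'i set" and a b :: "'i \<Rightarrow> 'a" and r :: "('k, 'a) tens2"
  assumes m: "bilinear_map s s m"
    and r: "r = (\<Sum>i\<in>I. tensor s (a i) (b i))"
begin

private lemma vs: "vector_space s"
  using m by (auto simp: bilinear_map_def Vector_Spaces.linear_def)

private lemma r_apply: "bilinear_map s (*) \<beta> \<Longrightarrow> r \<beta> = (\<Sum>i\<in>I. \<beta> (a i) (b i))"
  by (simp add: r sum_fun_apply tensor_def)

private lemma bil_sum:
  "(\<And>i. i \<in> I \<Longrightarrow> bilinear_map s (*) (\<lambda>x y. F x y i)) \<Longrightarrow>
    bilinear_map s (*) (\<lambda>x y. \<Sum>i\<in>I. F x y i)"
  unfolding bilinear_map_def by (auto intro!: linear_sum_functions[OF vs])

private lemma tri_comp: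
  assumes "trilinear_map s (*) \<gamma>" "Vector_Spaces.linear s s f"
  shows "Vector_Spaces.linear s (*) (\<lambda>x. \<gamma> (f x) y z)"
    and "Vector_Spaces.linear s (*) (\<lambda>x. \<gamma> y (f x) z)"
    and "Vector_Spaces.linear s (*) (\<lambda>x. \<gamma> y z (f x))"
  using assms(1)
  by (auto simp: trilinear_map_def intro: linear_compose2[OF assms(2), of "(*)" "\<lambda>x. \<gamma> x y z"]
      linear_compose2[OF assms(2), of "(*)" "\<lambda>x. \<gamma> y x z"]
      linear_compose2[OF assms(2), of "(*)" "\<lambda>x. \<gamma> y z x"])

private lemma tri_bil:
  assumes "trilinear_map s (*) \<gamma>"
  shows "bilinear_map s (*) (\<lambda>c d. \<gamma> (m x c) y d)" "bilinear_map s (*) (\<lambda>x y. \<gamma> (m x c) y d)"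
    and "bilinear_map s (*) (\<lambda>c d. \<gamma> x c (m y d))" "bilinear_map s (*) (\<lambda>x y. \<gamma> x c (m y d))"
    and "bilinear_map s (*) (\<lambda>c d. \<gamma> x (m y c) d)" "bilinear_map s (*) (\<lambda>x y. \<gamma> x (m y c) d)"
  using assms m tri_comp[OF assms]
  unfolding bilinear_map_def trilinear_map_def by simp_all

lemma r12_r13_sum:
  "r12_r13 s m r = (\<Sum>i\<in>I. \<Sum>j\<in>I. tensor3 s (m (a i) (a j)) (b i) (b j))"
proof
  fix \<gamma>
  show "r12_r13 s m r \<gamma> = (\<Sum>i\<in>I. \<Sum>j\<in>I. tensor3 s (m (a i) (a j)) (b i) (b j)) \<gamma>"
  proof (cases "trilinear_map s (*) \<gamma>")
    case True
    show ?thesis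
      using True by (simp add: r12_r13_def r_apply[OF tri_bil(1)[OF True]]
          r_apply[OF bil_sum[OF tri_bil(2)[OF True]]] sum_fun_apply tensor3_def)
  qed (simp add: r12_r13_def sum_fun_apply tensor3_def)
qed

lemma r13_r23_sum:
  "r13_r23 s m r = (\<Sum>i\<in>I. \<Sum>j\<in>I. tensor3 s (a i) (a j) (m (b i) (b j)))"
proof
  fix \<gamma>
  show "r13_r23 s m r \<gamma> = (\<Sum>i\<in>I. \<Sum>j\<in>I. tensor3 s (a i) (a j) (m (b i) (b j))) \<gamma>"
  proof (cases "trilinear_map s (*) \<gamma>")
    case True
    show ?thesis
      using True by (simp add: r13_r23_def r_apply[OF tri_bil(3)[OF True]]
          r_apply[OF bil_sum[OF tri_bil(4)[OF True]]] sum_fun_apply tensor3_def)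
  qed (simp add: r13_r23_def sum_fun_apply tensor3_def)
qed

lemma r12_r23_sum:
  "r12_r23 s m r = (\<Sum>i\<in>I. \<Sum>j\<in>I. tensor3 s (a i) (m (b i) (a j)) (b j))"
proof
  fix \<gamma>
  show "r12_r23 s m r \<gamma> = (\<Sum>i\<in>I. \<Sum>j\<in>I. tensor3 s (a i) (m (b i) (a j)) (b j)) \<gamma>"
  proof (cases "trilinear_map s (*) \<gamma>")
    case True
    show ?thesis
      using True by (simp add: r12_r23_def r_apply[OF tri_bil(5)[OF True]]
          r_apply[OF bil_sum[OF tri_bil(6)[OF True]]] sum_fun_apply tensor3_def)
  qed (simp add: r12_r23_def sum_fun_apply tensor3_def)
qed

end

end

theory Submission
  imports Defs
begin

text \<open>
  The flip anticommutes with \<open>L(x) \<otimes> id - id \<otimes> L(x)\<close>, so \<open>\<tau> (\<Delta> x) = \<Delta> x\<close> is condition (i); as products of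
  functionals span the bilinear forms in finite dimension, this is commutativity of \<open>\<diamond>\<close>. In the
  same way the Jacobi identity of \<open>\<diamond>\<close> says that the cyclic sum of \<open>(id \<otimes> \<Delta>) (\<Delta> x)\<close> vanishes on
  all trilinear forms. Under (i) this cyclic sum equals \<open>- Q(x) [[r, r]]\<close>: for skew \<open>r\<close> it is a
  computation with the Jacobi identity of \<open>A\<close>, and in general the error terms caused by
  \<open>r + \<tau> r \<noteq> 0\<close> cancel because \<open>L(x) \<otimes> id\<close> and \<open>id \<otimes> L(x)\<close> agree on \<open>r + \<tau> r\<close>.
  The compatibility of \<open>\<Delta>\<close> with the product holds for every \<open>r\<close>.
\<close>

section \<open>Pointwise rules for multilinear maps\<close>

lemma bilinear_mapI:
  assumes "vector_space s" "vector_space s'"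
    and "\<And>x x' y. f (x + x') y = f x y + f x' y" "\<And>x y y'. f x (y + y') = f x y + f x y'"
    and "\<And>c x y. f (s c x) y = s' c (f x y)" "\<And>c x y. f x (s c y) = s' c (f x y)"
  shows "bilinear_map s s' f"
  using assms by (simp add: bilinear_map_def linear_iff)

lemma trilinear_mapI:
  assumes "vector_space s" "vector_space s'"
    and "\<And>x x' y z. f (x + x') y z = f x y z + f x' y z"
    and "\<And>x y y' z. f x (y + y') z = f x y z + f x y' z"
    and "\<And>x y z z'. f x y (z + z') = f x y z + f x y z'"
    and "\<And>c x y z. f (s c x) y z = s' c (f x y z)"
    and "\<And>c x y z. f x (s c y) z = s' c (f x y z)"
    and "\<And>c x y z. f x y (s c z) = s' c (f x y z)"
  shows "trilinear_map s s' f"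
  using assms by (simp add: trilinear_map_def linear_iff)

lemma trilinear_mapD:
  assumes "trilinear_map s s' f"
  shows "f (x + x') y z = f x y z + f x' y z" "f x (y + y') z = f x y z + f x y' z"
    and "f x y (z + z') = f x y z + f x y z'"
    and "f (s c x) y z = s' c (f x y z)" "f x (s c y) z = s' c (f x y z)"
    and "f x y (s c z) = s' c (f x y z)"
  using assms by (simp_all add: trilinear_map_def linear_iff)

lemma trilinear_map_neg_diff:
  assumes "trilinear_map s s' f"
  shows "f (- x) y z = - f x y z" "f x (- y) z = - f x y z" "f x y (- z) = - f x y z"
    and "f (x - x') y z = f x y z - f x' y z" "f x (y - y') z = f x y z - f x y' z"
    and "f x y (z - z') = f x y z - f x y z'"
proof -
  interpret x: Vector_Spaces.linear s s' "\<lambda>x. f x y z" for y z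
    using assms by (simp add: trilinear_map_def)
  interpret y: Vector_Spaces.linear s s' "\<lambda>y. f x y z" for x z
    using assms by (simp add: trilinear_map_def)
  interpret z: Vector_Spaces.linear s s' "\<lambda>z. f x y z" for x y
    using assms by (simp add: trilinear_map_def)
  show "f (- x) y z = - f x y z" "f x (- y) z = - f x y z" "f x y (- z) = - f x y z"
    and "f (x - x') y z = f x y z - f x' y z" "f x (y - y') z = f x y z - f x y' z"
    and "f x y (z - z') = f x y z - f x y z'"
    by (fact x.neg y.neg z.neg x.diff y.diff z.diff)+
qed

lemma bilinear_map_neg_diff:
  assumes "bilinear_map s s' f"
  shows "f (- x) y = - f x y" "f x (- y) = - f x y"
    and "f (x - x') y = f x y - f x' y" "f x (y - y') = f x y - f x y'"
proof -
  interpret x: Vector_Spaces.linear s s' "\<lambda>x. f x y" for y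
    using assms by (simp add: bilinear_map_def)
  interpret y: Vector_Spaces.linear s s' "\<lambda>y. f x y" for x
    using assms by (simp add: bilinear_map_def)
  show "f (- x) y = - f x y" "f x (- y) = - f x y"
    and "f (x - x') y = f x y - f x' y" "f x (y - y') = f x y - f x y'"
    by (fact x.neg y.neg x.diff y.diff)+
qed

section \<open>The dual space and coordinate functionals\<close>

lemma dual_space_iff:
  assumes "vector_space s"
  shows "\<xi> \<in> dual_space s \<longleftrightarrow>
    (\<forall>x y. \<xi> (x + y) = \<xi> x + \<xi> y) \<and> (\<forall>c x. \<xi> (s c x) = c * \<xi> x)"
  using assms by (simp add: dual_space_def linear_iff vector_space_times)

lemma dual_space_sum:
  assumes "\<xi> \<in> dual_space s"
  shows "\<xi> (\<Sum>i\<in>I. s (c i) (v i)) = (\<Sum>i\<in>I. c i * \<xi> (v i))"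
proof -
  interpret Vector_Spaces.linear s "(*)" \<xi>
    using assms by (simp add: dual_space_def)
  show ?thesis by (simp add: sum scale)
qed

lemma dual_space_add:
  assumes "vector_space s" "\<xi> \<in> dual_space s" "\<eta> \<in> dual_space s"
  shows "\<xi> + \<eta> \<in> dual_space s"
  using assms by (simp add: dual_space_iff algebra_simps)

lemma dual_space_scale:
  assumes "vector_space s" "\<xi> \<in> dual_space s"
  shows "fun_scale c \<xi> \<in> dual_space s"
  using assms by (simp add: dual_space_iff fun_scale_def algebra_simps)

lemma subspace_dual_space:
  fixes s :: "'k::field \<Rightarrow> 'a::ab_group_add \<Rightarrow> 'a"
  assumes "vector_space s"
  shows "module.subspace fun_scale (dual_space s)"
proof -
  interpret fs: vector_space "fun_scale :: 'k \<Rightarrow> ('a \<Rightarrow> 'k) \<Rightarrow> _"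
    by (rule vector_space_fun_scale)
  show ?thesis
    using assms by (intro fs.subspaceI dual_space_add dual_space_scale)
      (auto simp: dual_space_iff)
qed

text \<open>A maximal independent set spans, and the size of \<open>B0\<close> bounds it. The
  \<open>\<phi> e\<close> are its coordinate functionals; finite dimension enters the later
  arguments through this expansion of \<open>v\<close>.\<close>

lemma (in vector_space) dual_basis_exists:
  assumes "finite B0" "span B0 = UNIV"
  obtains B \<phi> where "finite B" "\<And>e. e \<in> B \<Longrightarrow> \<phi> e \<in> dual_space scale"
    "\<And>v. (\<Sum>e\<in>B. scale (\<phi> e v) e) = v"
proof -
  obtain B where B: "independent B" "UNIV \<subseteq> span B"
    using maximal_independent_subset[of UNIV] by blast
  then have sp: "span B = UNIV" by auto
  have fin: "finite B"
    using independent_span_bound[OF assms(1) B(1)] assms(2) by simp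
  show thesis
  proof (rule that[OF fin])
    show "(\<lambda>v. representation B v e) \<in> dual_space scale" for e
      using linear_representation[OF B(1) sp] by (simp add: dual_space_def)
    show "(\<Sum>e\<in>B. scale (representation B v e) e) = v" for v
      using B(1) fin by (simp add: sum_representation_eq sp)
  qed
qed

text \<open>Applying \<open>\<xi>\<close> to the expansion of \<open>v\<close> writes
  \<open>\<xi>\<close> as the combination of the \<open>\<phi> e\<close> with coefficients
  \<open>\<xi> e\<close>, so the coordinate functionals span the dual.\<close>

lemma finite_dim_dual_space:
  fixes s :: "'k::field \<Rightarrow> 'a::ab_group_add \<Rightarrow> 'a"
  assumes s: "vector_space s" and "finite B0" "module.span s B0 = UNIV"
  shows "\<exists>B. finite B \<and> module.span fun_scale B = dual_space s"
proof -
  interpret s: vector_space s by (fact s)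
  interpret fs: vector_space "fun_scale :: 'k \<Rightarrow> ('a \<Rightarrow> 'k) \<Rightarrow> _"
    by (rule vector_space_fun_scale)
  obtain B \<phi> where B: "finite B" "\<And>e. e \<in> B \<Longrightarrow> \<phi> e \<in> dual_space s"
    "\<And>v. (\<Sum>e\<in>B. s (\<phi> e v) e) = v"
    using s.dual_basis_exists[OF assms(2,3)] by metis
  have "\<xi> \<in> fs.span (\<phi> ` B)" if "\<xi> \<in> dual_space s" for \<xi>
  proof -
    have "\<xi> = (\<Sum>e\<in>B. fun_scale (\<xi> e) (\<phi> e))"
    proof
      fix v
      show "\<xi> v = (\<Sum>e\<in>B. fun_scale (\<xi> e) (\<phi> e)) v"
        using dual_space_sum[OF that, of "\<lambda>e. \<phi> e v" "\<lambda>e. e" B]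
        by (simp add: B(3) sum_fun_apply fun_scale_def mult.commute)
    qed
    also have "\<dots> \<in> fs.span (\<phi> ` B)"
      by (intro fs.span_sum fs.span_scale fs.span_base imageI)
    finally show ?thesis .
  qed
  moreover have "fs.span (\<phi> ` B) \<subseteq> dual_space s"
    using B(2) by (intro fs.span_minimal subspace_dual_space s) auto
  ultimately show ?thesis
    using B(1) by blast
qed

section \<open>Multilinear forms as sums of products of functionals\<close>

text \<open>Expanding the first argument gives
  \<open>\<beta> u v = (\<Sum>e\<in>B. \<phi> e u * \<beta> e v)\<close>, and each
  \<open>\<beta> e\<close> is a functional. As an induction rule this reduces additive statements
  about bilinear forms to products \<open>\<xi> u * \<eta> v\<close>.\<close>

lemma bilinear_form_induct [consumes 4, case_names zero add]:
  assumes s: "vector_space s" and "finite B0" "module.span s B0 = UNIV"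
    and \<beta>: "bilinear_map s (*) \<beta>"
    and zero: "P (\<lambda>_ _. 0)"
    and add: "\<And>\<xi> \<eta> \<beta>. \<xi> \<in> dual_space s \<Longrightarrow> \<eta> \<in> dual_space s \<Longrightarrow> P \<beta> \<Longrightarrow>
      P (\<lambda>u v. \<xi> u * \<eta> v + \<beta> u v)"
  shows "P \<beta>"
proof -
  interpret s: vector_space s by (fact s)
  obtain B \<phi> where B: "finite B" "\<And>e. e \<in> B \<Longrightarrow> \<phi> e \<in> dual_space s"
    "\<And>v. (\<Sum>e\<in>B. s (\<phi> e v) e) = v"
    using s.dual_basis_exists[OF assms(2,3)] by metis
  have dual: "\<beta> e \<in> dual_space s" "(\<lambda>u. \<beta> u v) \<in> dual_space s" for e v
    using \<beta> by (simp_all add: dual_space_def bilinear_map_def)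
  \<comment> \<open>The sum grows over subsets of the basis, because \<open>add\<close> attaches one
    product at a time.\<close>
  have "P (\<lambda>u v. \<Sum>e\<in>C. \<phi> e u * \<beta> e v)" if "C \<subseteq> B" for C
    using finite_subset[OF that B(1)] that
    by (induction C) (simp_all add: zero add B(2) dual)
  moreover have "(\<Sum>e\<in>B. \<phi> e u * \<beta> e v) = \<beta> u v" for u v
    using dual_space_sum[OF dual(2), of "\<lambda>e. \<phi> e u" "\<lambda>e. e" B] by (simp add: B(3))
  ultimately show ?thesis
    by (metis (no_types, lifting) ext order_refl)
qed

text \<open>Expanding the first argument leaves summands \<open>\<phi> e u * \<gamma> e v w\<close>
  with \<open>\<gamma> e\<close> bilinear, which the bilinear rule splits further.\<close>

lemma trilinear_form_induct [consumes 4, case_names zero add]: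
  assumes s: "vector_space s" and "finite B0" "module.span s B0 = UNIV"
    and \<gamma>: "trilinear_map s (*) \<gamma>"
    and zero: "P (\<lambda>_ _ _. 0)"
    and add: "\<And>\<xi> \<eta> \<zeta> \<gamma>. \<xi> \<in> dual_space s \<Longrightarrow> \<eta> \<in> dual_space s \<Longrightarrow> \<zeta> \<in> dual_space s \<Longrightarrow>
      P \<gamma> \<Longrightarrow> P (\<lambda>u v w. \<xi> u * \<eta> v * \<zeta> w + \<gamma> u v w)"
  shows "P \<gamma>"
proof -
  interpret s: vector_space s by (fact s)
  obtain B \<phi> where B: "finite B" "\<And>e. e \<in> B \<Longrightarrow> \<phi> e \<in> dual_space s"
    "\<And>v. (\<Sum>e\<in>B. s (\<phi> e v) e) = v"
    using s.dual_basis_exists[OF assms(2,3)] by metis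
  have bil: "bilinear_map s (*) (\<gamma> e)" and dual: "(\<lambda>u. \<gamma> u v w) \<in> dual_space s" for e v w
    using \<gamma> by (simp_all add: dual_space_def trilinear_map_def bilinear_map_def)
  \<comment> \<open>The induction on \<open>\<beta>\<close> carries \<open>\<gamma>'\<close> along,
    so its base case is \<open>P \<gamma>'\<close>.\<close>
  have step: "P (\<lambda>u v w. \<xi> u * \<beta> v w + \<gamma>' u v w)"
    if "bilinear_map s (*) \<beta>" "\<xi> \<in> dual_space s" "P \<gamma>'" for \<xi> \<beta> \<gamma>'
    using s assms(2,3) that(1)
  proof (induction rule: bilinear_form_induct)
    case zero
    show ?case using that(3) by simp
  next
    case (add \<eta> \<zeta> \<beta>)
    then show ?case
      using assms(6)[OF that(2) add(1,2) add(3)] by (simp add: algebra_simps)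
  qed
  have "P (\<lambda>u v w. \<Sum>e\<in>C. \<phi> e u * \<gamma> e v w)" if "C \<subseteq> B" for C
    using finite_subset[OF that B(1)] that
    by (induction C) (simp_all add: zero step B(2) bil)
  moreover have "(\<Sum>e\<in>B. \<phi> e u * \<gamma> e v w) = \<gamma> u v w" for u v w
    using dual_space_sum[OF dual, of "\<lambda>e. \<phi> e u" "\<lambda>e. e" B] by (simp add: B(3))
  ultimately show ?thesis
    by (metis (no_types, lifting) ext order_refl)
qed

text \<open>A double sum is unchanged when its indices are swapped, so symmetrising the summand
  doubles it, and characteristic zero cancels the 2. When \<open>i\<close> and \<open>j\<close>
  index two copies of \<open>r\<close>, the swap exchanges the copies.\<close>

lemma double_sum_symmetrized_eqI:
  fixes F G :: "'i \<Rightarrow> 'i \<Rightarrow> 'k::field_char_0"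
  assumes "\<And>i j. F i j + F j i = G i j + G j i"
  shows "(\<Sum>i\<in>I. \<Sum>j\<in>I. F i j) = (\<Sum>i\<in>I. \<Sum>j\<in>I. G i j)"
proof -
  have double: "(\<Sum>i\<in>I. \<Sum>j\<in>I. H i j + H j i) = 2 * (\<Sum>i\<in>I. \<Sum>j\<in>I. H i j)"
    for H :: "'i \<Rightarrow> 'i \<Rightarrow> 'k"
  proof -
    have "(\<Sum>i\<in>I. \<Sum>j\<in>I. H j i) = (\<Sum>i\<in>I. \<Sum>j\<in>I. H i j)"
      by (rule sum.swap)
    then show ?thesis
      by (simp only: sum.distrib mult_2)
  qed
  have "2 * (\<Sum>i\<in>I. \<Sum>j\<in>I. F i j) = 2 * (\<Sum>i\<in>I. \<Sum>j\<in>I. G i j)"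
    unfolding double[symmetric] assms ..
  then show ?thesis
    by simp
qed

section \<open>The coproduct induced by \<open>r\<close> and its dual product\<close>

text \<open>Fixing one decomposition of \<open>r\<close> into pure tensors turns its value at a
  bilinear form into a finite sum, so that identities can be checked on summands.\<close>

locale coboundary_comultiplication = mock_lie_algebra s UNIV m
  for s :: "'k::field_char_0 \<Rightarrow> 'a::ab_group_add \<Rightarrow> 'a" and m :: "'a \<Rightarrow> 'a \<Rightarrow> 'a" +
  fixes r :: "('k, 'a) tens2" and n :: nat and a b :: "nat \<Rightarrow> 'a"
  assumes r_sum: "r = (\<Sum>i<n. tensor s (a i) (b i))"
begin

lemmas m_linear = mult_add_left[OF UNIV_I UNIV_I UNIV_I] mult_add_right[OF UNIV_I UNIV_I UNIV_I]
  mult_scale_left[OF UNIV_I UNIV_I] mult_scale_right[OF UNIV_I UNIV_I]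

lemma m_commute: "m x y = m y x"
  by (simp add: mult_commute)

text \<open>The Jacobi identity solved for one term: \<open>L(x)\<close> is a derivation up to sign.
  It is oriented to move \<open>x\<close> from the outside of a product to the inside.\<close>

lemma m_jacobi: "m x (m y z) = - m (m x y) z - m (m x z) y"
  using jacobi[of x y z] m_commute[of y "m z x"] m_commute[of z "m x y"] m_commute[of z x]
  by (simp add: eq_neg_iff_add_eq_0 algebra_simps)

lemma bilinear_m: "bilinear_map s s m"
  by (intro bilinear_mapI vector_space_axioms m_linear)

lemmas formI = bilinear_mapI[OF vector_space_axioms vector_space_times]
  trilinear_mapI[OF vector_space_axioms vector_space_times]

abbreviation \<Delta> :: "'a \<Rightarrow> ('k, 'a) tens2"
  where "\<Delta> x \<equiv> tensor_L_minus s m x r"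

lemma r_apply:
  assumes "bilinear_map s (*) \<beta>"
  shows "r \<beta> = (\<Sum>i<n. \<beta> (a i) (b i))"
  using assms by (simp add: r_sum sum_fun_apply tensor_def)

lemma bilinear_compose:
  assumes "bilinear_map s (*) \<beta>"
  shows "bilinear_map s (*) (\<lambda>u v. \<beta> (m x u) v)" "bilinear_map s (*) (\<lambda>u v. \<beta> u (m x v))"
    and "bilinear_map s (*) (\<lambda>u v. \<beta> v u)"
  by (intro formI; simp add: m_linear bilinear_mapD[OF assms])+

lemma trilinear_compose:
  assumes "trilinear_map s (*) \<gamma>"
  shows "trilinear_map s (*) (\<lambda>u v w. \<gamma> (m x u) v w)"
    and "trilinear_map s (*) (\<lambda>u v w. \<gamma> u (m x v) w)"
    and "trilinear_map s (*) (\<lambda>u v w. \<gamma> u v (m x w))"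
  by (intro formI; simp add: m_linear trilinear_mapD[OF assms])+

lemma \<Delta>_apply:
  "\<Delta> x \<beta> = (if bilinear_map s (*) \<beta> then
    \<Sum>i<n. \<beta> (m x (a i)) (b i) - \<beta> (a i) (m x (b i)) else 0)"
  by (simp add: tensor_L_minus_def tensor_map_def r_apply bilinear_compose sum_subtractf)

text \<open>The minus sign is absorbed into the first tensor factor, so that
  \<open>\<Delta> x\<close> is visibly a sum of pure tensors.\<close>

lemma \<Delta>_sum: "\<Delta> x = (\<Sum>i<n. tensor s (m x (a i)) (b i)) + (\<Sum>i<n. tensor s (- a i) (m x (b i)))"
  by (auto simp: fun_eq_iff \<Delta>_apply sum_fun_apply sum_subtractf sum_negf tensor_def
      bilinear_map_neg_diff)

lemma \<Delta>_in_tensor_space: "\<Delta> x \<in> tensor_space s"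
proof -
  interpret fs: vector_space "fun_scale :: 'k \<Rightarrow> (('a \<Rightarrow> 'a \<Rightarrow> 'k) \<Rightarrow> 'k) \<Rightarrow> _"
    by (rule vector_space_fun_scale)
  show ?thesis
    unfolding \<Delta>_sum tensor_space_def
    by (intro fs.span_add fs.span_sum fs.span_base) blast+
qed

lemma linear_\<Delta>: "Vector_Spaces.linear s fun_scale \<Delta>"
  by (auto simp: linear_iff vector_space_axioms vector_space_fun_scale fun_eq_iff \<Delta>_apply
      m_linear bilinear_mapD fun_scale_def sum.distrib sum_subtractf sum_distrib_left algebra_simps)

lemma flip_\<Delta>_apply:
  "(tensor_flip s (\<Delta> x) - \<Delta> x) \<beta> = - tensor_L_minus s m x (r + tensor_flip s r) \<beta>"
  by (auto simp: tensor_flip_def tensor_L_minus_def tensor_map_def r_apply bilinear_compose)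

lemma flip_\<Delta>_iff: "tensor_flip s (\<Delta> x) = \<Delta> x \<longleftrightarrow> tensor_L_minus s m x (r + tensor_flip s r) = 0"
  using flip_\<Delta>_apply[of x] by (auto simp: fun_eq_iff)

text \<open>On the right the mixed parts \<open>L(x) \<otimes> L(y)\<close> and
  \<open>L(y) \<otimes> L(x)\<close> cancel. What remains is \<open>-(L(x) L(y) + L(y) L(x))\<close>
  in the first factor minus the same in the second, and by Jacobi this operator is
  \<open>L(m x y)\<close>.\<close>

lemma \<Delta>_mult: "\<Delta> (m x y) = - tensor_L_plus s m x (\<Delta> y) - tensor_L_plus s m y (\<Delta> x)"
proof
  fix \<beta>
  show "\<Delta> (m x y) \<beta> = (- tensor_L_plus s m x (\<Delta> y) - tensor_L_plus s m y (\<Delta> x)) \<beta>"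
  proof (cases "bilinear_map s (*) \<beta>")
    case True
    have jac: "m (m x y) z = - m x (m y z) - m y (m x z)" for z
      by (simp add: m_jacobi[of x y z] m_commute[of "m x z" y])
    show ?thesis
      using True by (simp add: tensor_L_plus_def tensor_map_def \<Delta>_apply bilinear_compose jac
          bilinear_map_neg_diff[OF True] sum.distrib sum_subtractf sum_negf)
  qed (simp add: tensor_L_plus_def tensor_map_def \<Delta>_apply)
qed

lemma dual_product_apply:
  assumes "\<xi> \<in> dual_space s" "\<eta> \<in> dual_space s"
  shows "dual_product \<Delta> \<xi> \<eta> x = (\<Sum>i<n. \<xi> (m x (a i)) * \<eta> (b i) - \<xi> (a i) * \<eta> (m x (b i)))"
  using bilinear_mult_forms[OF assms]
  by (simp add: dual_product_def tensor_pairing_def \<Delta>_apply)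

lemma dual_product_in_dual:
  assumes "\<xi> \<in> dual_space s" "\<eta> \<in> dual_space s"
  shows "dual_product \<Delta> \<xi> \<eta> \<in> dual_space s"
  using assms
  by (simp add: dual_space_iff[OF vector_space_axioms] dual_product_apply[OF assms] m_linear
      sum.distrib sum_subtractf sum_distrib_left algebra_simps)

lemma dual_product_add:
  assumes "\<xi> \<in> dual_space s" "\<eta> \<in> dual_space s" "\<zeta> \<in> dual_space s"
  shows "dual_product \<Delta> (\<xi> + \<eta>) \<zeta> = dual_product \<Delta> \<xi> \<zeta> + dual_product \<Delta> \<eta> \<zeta>"
    and "dual_product \<Delta> \<zeta> (\<xi> + \<eta>) = dual_product \<Delta> \<zeta> \<xi> + dual_product \<Delta> \<zeta> \<eta>"
  using assms dual_space_add[OF vector_space_axioms assms(1,2)]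
  by (simp_all add: fun_eq_iff dual_product_apply sum.distrib sum_subtractf algebra_simps)

lemma dual_product_scale:
  assumes "\<xi> \<in> dual_space s" "\<eta> \<in> dual_space s"
  shows "dual_product \<Delta> (fun_scale c \<xi>) \<eta> = fun_scale c (dual_product \<Delta> \<xi> \<eta>)"
    and "dual_product \<Delta> \<xi> (fun_scale c \<eta>) = fun_scale c (dual_product \<Delta> \<xi> \<eta>)"
  using assms dual_space_scale[OF vector_space_axioms assms(1), of c]
    dual_space_scale[OF vector_space_axioms assms(2), of c]
  by (simp_all add: fun_eq_iff dual_product_apply fun_scale_def sum_distrib_left algebra_simps)

text \<open>Closure and bilinearity follow from the formula for the product, which leaves
  commutativity and Jacobi. \<open>dia\<close> is a separate variable because its values are
  prescribed on the dual space alone.\<close>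

lemma dual_mock_lie_iff:
  assumes dia: "\<And>\<xi> \<eta>. \<xi> \<in> dual_space s \<Longrightarrow> \<eta> \<in> dual_space s \<Longrightarrow> dia \<xi> \<eta> = dual_product \<Delta> \<xi> \<eta>"
  shows "mock_lie_algebra fun_scale (dual_space s) dia \<longleftrightarrow>
    (\<forall>\<xi>\<in>dual_space s. \<forall>\<eta>\<in>dual_space s. dual_product \<Delta> \<xi> \<eta> = dual_product \<Delta> \<eta> \<xi>) \<and>
    (\<forall>\<xi>\<in>dual_space s. \<forall>\<eta>\<in>dual_space s. \<forall>\<zeta>\<in>dual_space s.
      dual_product \<Delta> \<xi> (dual_product \<Delta> \<eta> \<zeta>) + dual_product \<Delta> \<eta> (dual_product \<Delta> \<zeta> \<xi>) +
      dual_product \<Delta> \<zeta> (dual_product \<Delta> \<xi> \<eta>) = 0)" (is "?L \<longleftrightarrow> ?comm \<and> ?jac")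
proof
  assume ?L
  then interpret d: mock_lie_algebra fun_scale "dual_space s" dia .
  show "?comm \<and> ?jac"
    using d.mult_commute d.jacobi by (simp add: dia dual_product_in_dual)
next
  assume R: "?comm \<and> ?jac"
  interpret fs: vector_space "fun_scale :: 'k \<Rightarrow> ('a \<Rightarrow> 'k) \<Rightarrow> _"
    by (rule vector_space_fun_scale)
  note closed = dual_space_add[OF vector_space_axioms] dual_space_scale[OF vector_space_axioms]
    dual_product_in_dual
  show ?L
  proof
    show "fs.subspace (dual_space s)"
      by (rule subspace_dual_space[OF vector_space_axioms])
    show "\<exists>B. finite B \<and> fs.span B = dual_space s"
      using finite_dim finite_dim_dual_space[OF vector_space_axioms] by blast
    show "dia \<xi> \<eta> = dia \<eta> \<xi>" if "\<xi> \<in> dual_space s" "\<eta> \<in> dual_space s" for \<xi> \<eta>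
      using conjunct1[OF R] that by (simp only: dia)
    show "dia \<xi> (dia \<eta> \<zeta>) + dia \<eta> (dia \<zeta> \<xi>) + dia \<zeta> (dia \<xi> \<eta>) = 0"
      if "\<xi> \<in> dual_space s" "\<eta> \<in> dual_space s" "\<zeta> \<in> dual_space s" for \<xi> \<eta> \<zeta>
      using conjunct2[OF R] that by (simp only: dia dual_product_in_dual)
  qed (simp_all add: dia closed dual_product_add dual_product_scale)
qed

section \<open>Commutativity and the Jacobi identity tested on all forms\<close>

lemma dual_product_commute_iff:
  "(\<forall>\<xi>\<in>dual_space s. \<forall>\<eta>\<in>dual_space s. dual_product \<Delta> \<xi> \<eta> = dual_product \<Delta> \<eta> \<xi>) \<longleftrightarrow>
    (\<forall>x. tensor_flip s (\<Delta> x) = \<Delta> x)" (is "?L \<longleftrightarrow> ?R")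
proof
  assume L: ?L
  show ?R
  proof (intro allI ext)
    fix x \<beta>
    show "tensor_flip s (\<Delta> x) \<beta> = \<Delta> x \<beta>"
    proof (cases "bilinear_map s (*) \<beta>")
      case True
      obtain B0 where "finite B0" "span B0 = UNIV" using finite_dim by blast
      \<comment> \<open>The claim uses explicit sums, which are additive in any
        \<open>\<beta>\<close>. The functional \<open>\<Delta> x\<close> itself is set to 0 off the
        bilinear forms, and the induction hypothesis does not supply bilinearity.\<close>
      from vector_space_axioms this True
      have "(\<Sum>i<n. \<beta> (b i) (m x (a i)) - \<beta> (m x (b i)) (a i)) =
        (\<Sum>i<n. \<beta> (m x (a i)) (b i) - \<beta> (a i) (m x (b i)))"
      proof (induction rule: bilinear_form_induct)
        case (add \<xi> \<eta> \<beta>)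
        then have "dual_product \<Delta> \<eta> \<xi> x = dual_product \<Delta> \<xi> \<eta> x" using L by simp
        with add show ?case
          by (simp add: dual_product_apply sum.distrib sum_subtractf algebra_simps)
      qed simp
      with True show ?thesis
        by (simp add: tensor_flip_def \<Delta>_apply bilinear_compose)
    qed (simp add: tensor_flip_def \<Delta>_apply)
  qed
next
  assume R: ?R
  show ?L
  proof (intro ballI ext)
    fix \<xi> \<eta> x
    assume d: "\<xi> \<in> dual_space s" "\<eta> \<in> dual_space s"
    \<comment> \<open>Symmetry of \<open>\<Delta> x\<close> is evaluated at the bilinear form
      \<open>\<xi> u * \<eta> v\<close>; flipping its arguments gives the pairing in the opposite
      order.\<close>
    show "dual_product \<Delta> \<xi> \<eta> x = dual_product \<Delta> \<eta> \<xi> x"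
      using fun_cong[OF R[rule_format, of x], of "\<lambda>u v. \<xi> u * \<eta> v"] d
        bilinear_mult_forms[OF d] bilinear_mult_forms[OF d(2,1)]
      by (simp add: tensor_flip_def dual_product_def tensor_pairing_def mult.commute)
  qed
qed

text \<open>\<open>(id \<otimes> \<Delta>) (\<Delta> x)\<close> evaluated at a trilinear form\<close>

definition iterated_\<Delta> :: "'a \<Rightarrow> ('a \<Rightarrow> 'a \<Rightarrow> 'a \<Rightarrow> 'k) \<Rightarrow> 'k"
  where "iterated_\<Delta> x \<gamma> = (\<Sum>i<n. \<Sum>j<n.
    \<gamma> (m x (a i)) (m (b i) (a j)) (b j) - \<gamma> (m x (a i)) (a j) (m (b i) (b j))
    - \<gamma> (a i) (m (m x (b i)) (a j)) (b j) + \<gamma> (a i) (a j) (m (m x (b i)) (b j)))"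

text \<open>Rotating the three tensor factors is expressed by rotating the arguments of
  \<open>\<gamma>\<close>.\<close>

definition cyclic_\<Delta> :: "'a \<Rightarrow> ('a \<Rightarrow> 'a \<Rightarrow> 'a \<Rightarrow> 'k) \<Rightarrow> 'k"
  where "cyclic_\<Delta> x \<gamma> = iterated_\<Delta> x \<gamma> + iterated_\<Delta> x (\<lambda>u v w. \<gamma> w u v) +
    iterated_\<Delta> x (\<lambda>u v w. \<gamma> v w u)"

text \<open>Serves the induction over trilinear forms, where the form built so far is known only to
  make the cyclic sum vanish.\<close>

lemma cyclic_\<Delta>_add: "cyclic_\<Delta> x (\<lambda>u v w. \<gamma> u v w + \<gamma>' u v w) = cyclic_\<Delta> x \<gamma> + cyclic_\<Delta> x \<gamma>'"
  by (simp add: cyclic_\<Delta>_def iterated_\<Delta>_def sum.distrib sum_subtractf algebra_simps)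

text \<open>The dual product is the transpose of \<open>\<Delta>\<close>, so nesting it on the right
  transposes \<open>(id \<otimes> \<Delta>) (\<Delta> x)\<close>.\<close>

lemma dual_product_iterated:
  assumes "\<xi> \<in> dual_space s" "\<eta> \<in> dual_space s" "\<zeta> \<in> dual_space s"
  shows "dual_product \<Delta> \<xi> (dual_product \<Delta> \<eta> \<zeta>) x = iterated_\<Delta> x (\<lambda>u v w. \<xi> u * \<eta> v * \<zeta> w)"
  using assms
  by (simp add: dual_product_apply dual_product_in_dual iterated_\<Delta>_def sum_distrib_left
      sum_subtractf sum.distrib algebra_simps)

lemma cyclic_\<Delta>_dual:
  assumes "\<xi> \<in> dual_space s" "\<eta> \<in> dual_space s" "\<zeta> \<in> dual_space s"
  shows "(dual_product \<Delta> \<xi> (dual_product \<Delta> \<eta> \<zeta>) + dual_product \<Delta> \<eta> (dual_product \<Delta> \<zeta> \<xi>) +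
      dual_product \<Delta> \<zeta> (dual_product \<Delta> \<xi> \<eta>)) x = cyclic_\<Delta> x (\<lambda>u v w. \<xi> u * \<eta> v * \<zeta> w)"
  using assms by (simp add: cyclic_\<Delta>_def dual_product_iterated mult_ac)

lemma dual_product_jacobi_iff:
  "(\<forall>\<xi>\<in>dual_space s. \<forall>\<eta>\<in>dual_space s. \<forall>\<zeta>\<in>dual_space s.
      dual_product \<Delta> \<xi> (dual_product \<Delta> \<eta> \<zeta>) + dual_product \<Delta> \<eta> (dual_product \<Delta> \<zeta> \<xi>) +
      dual_product \<Delta> \<zeta> (dual_product \<Delta> \<xi> \<eta>) = 0) \<longleftrightarrow>
    (\<forall>x \<gamma>. trilinear_map s (*) \<gamma> \<longrightarrow> cyclic_\<Delta> x \<gamma> = 0)" (is "?L \<longleftrightarrow> ?R")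
proof
  assume L: ?L
  show ?R
  proof (intro allI impI)
    fix x \<gamma>
    assume \<gamma>: "trilinear_map s (*) \<gamma>"
    obtain B0 where "finite B0" "span B0 = UNIV" using finite_dim by blast
    from vector_space_axioms this \<gamma> show "cyclic_\<Delta> x \<gamma> = 0"
    proof (induction rule: trilinear_form_induct)
      case zero
      show ?case by (simp add: cyclic_\<Delta>_def iterated_\<Delta>_def)
    next
      case (add \<xi> \<eta> \<zeta> \<gamma>)
      then show ?case
        using L cyclic_\<Delta>_dual[of \<xi> \<eta> \<zeta> x] by (simp add: cyclic_\<Delta>_add)
    qed
  qed
next
  assume R: ?R
  show ?L
  proof (intro ballI ext)
    fix \<xi> \<eta> \<zeta> x
    assume d: "\<xi> \<in> dual_space s" "\<eta> \<in> dual_space s" "\<zeta> \<in> dual_space s"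
    have "trilinear_map s (*) (\<lambda>u v w. \<xi> u * \<eta> v * \<zeta> w)"
      using d by (intro formI) (simp_all add: dual_space_iff[OF vector_space_axioms] algebra_simps)
    then show "(dual_product \<Delta> \<xi> (dual_product \<Delta> \<eta> \<zeta>) + dual_product \<Delta> \<eta> (dual_product \<Delta> \<zeta> \<xi>) +
      dual_product \<Delta> \<zeta> (dual_product \<Delta> \<xi> \<eta>)) x = 0 x"
      unfolding cyclic_\<Delta>_dual[OF d] using R by simp
  qed
qed

section \<open>The bracket \<open>[[r, r]]\<close> and the operator \<open>Q(x)\<close>\<close>

lemma rr_bracket_apply:
  assumes "trilinear_map s (*) \<gamma>"
  shows "rr_bracket s m r \<gamma> = (\<Sum>i<n. \<Sum>j<n. \<gamma> (m (a i) (a j)) (b i) (b j) +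
    \<gamma> (a i) (a j) (m (b i) (b j)) - \<gamma> (a i) (m (b i) (a j)) (b j))"
  using assms
  by (simp add: rr_bracket_def r12_r13_sum[OF bilinear_m r_sum] r13_r23_sum[OF bilinear_m r_sum]
      r12_r23_sum[OF bilinear_m r_sum] sum_fun_apply tensor3_def sum.distrib sum_subtractf)

lemma tensor_Q_apply:
  assumes "trilinear_map s (*) \<gamma>"
  shows "tensor_Q s m x t \<gamma> = t (\<lambda>u v w. \<gamma> (m x u) v w) + t (\<lambda>u v w. \<gamma> u (m x v) w) +
    t (\<lambda>u v w. \<gamma> u v (m x w))"
  using assms by (simp add: tensor_Q_def tensor_map3_def)

text \<open>Condition (i) read at a form: \<open>L(x) \<otimes> id\<close> and
  \<open>id \<otimes> L(x)\<close> agree on \<open>r + \<tau> r\<close>. The error terms below are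
  recognised in this shape.\<close>

lemma symmetric_\<Delta>D:
  assumes "tensor_flip s (\<Delta> x) = \<Delta> x" "bilinear_map s (*) \<beta>"
  shows "(\<Sum>i<n. \<beta> (m x (a i)) (b i) - \<beta> (a i) (m x (b i)) +
    \<beta> (m x (b i)) (a i) - \<beta> (b i) (m x (a i))) = 0"
  using fun_cong[OF assms(1)[symmetric], of \<beta>] assms(2)
  by (simp add: tensor_flip_def \<Delta>_apply bilinear_compose sum.distrib sum_subtractf)

text \<open>
  Modulo the Jacobi identity and exchanging the two copies of \<open>r\<close>, the difference of the two sides
  is a signed sum of seven instances of the invariance of \<open>r + \<tau> r\<close>.
\<close>

lemma cyclic_\<Delta>_eq_Q:
  assumes sym: "\<And>x. tensor_flip s (\<Delta> x) = \<Delta> x" and \<gamma>: "trilinear_map s (*) \<gamma>"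
  shows "cyclic_\<Delta> x \<gamma> = - tensor_Q s m x (rr_bracket s m r) \<gamma>"
proof -
  \<comment> \<open>One summand of the invariance relation, so that whole relations can be placed
    under a double sum.\<close>
  define I where "I y \<beta> i = \<beta> (m y (a i)) (b i) - \<beta> (a i) (m y (b i)) +
    \<beta> (m y (b i)) (a i) - \<beta> (b i) (m y (a i))" for y and \<beta> :: "'a \<Rightarrow> 'a \<Rightarrow> 'k" and i
  have I: "(\<Sum>i<n. I y \<beta> i) = 0" if "bilinear_map s (*) \<beta>" for y \<beta>
    using symmetric_\<Delta>D[OF sym that] by (simp add: I_def)
  \<comment> \<open>Each form freezes the legs \<open>a i\<close> and \<open>b i\<close> of one copy
    of \<open>r\<close>, in arguments of \<open>\<gamma>\<close> or in the acting element, and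
    applies the relation to the other copy. Hence the sum over \<open>j\<close> vanishes for every
    fixed \<open>i\<close>.\<close>
  have [simp]: "(\<Sum>j<n. I x (\<lambda>u v. \<gamma> (m u (b i)) v (a i)) j) = 0"
    "(\<Sum>j<n. I x (\<lambda>u v. \<gamma> (m u (a i)) (b i) v) j) = 0"
    "(\<Sum>j<n. I (m x (a i)) (\<lambda>u v. \<gamma> u (b i) v) j) = 0"
    "(\<Sum>j<n. I (a i) (\<lambda>u v. \<gamma> u (m x (b i)) v) j) = 0"
    "(\<Sum>j<n. I x (\<lambda>u v. \<gamma> (a i) (m u (b i)) v) j) = 0"
    "(\<Sum>j<n. I x (\<lambda>u v. \<gamma> (a i) u (m v (b i))) j) = 0"
    "(\<Sum>j<n. I x (\<lambda>u v. \<gamma> (b i) u (m v (a i))) j) = 0" for i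
    by (intro I formI; simp add: m_linear trilinear_mapD[OF \<gamma>])+
  have "cyclic_\<Delta> x \<gamma> + tensor_Q s m x (rr_bracket s m r) \<gamma> = (\<Sum>i<n. \<Sum>j<n.
      I x (\<lambda>u v. \<gamma> (m u (b i)) v (a i)) j - I x (\<lambda>u v. \<gamma> (m u (a i)) (b i) v) j
      - I (m x (a i)) (\<lambda>u v. \<gamma> u (b i) v) j + I (a i) (\<lambda>u v. \<gamma> u (m x (b i)) v) j
      + I x (\<lambda>u v. \<gamma> (a i) (m u (b i)) v) j
      + I x (\<lambda>u v. \<gamma> (a i) u (m v (b i))) j + I x (\<lambda>u v. \<gamma> (b i) u (m v (a i))) j)"
    unfolding cyclic_\<Delta>_def iterated_\<Delta>_def tensor_Q_apply[OF \<gamma>]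
      rr_bracket_apply[OF trilinear_compose(1)[OF \<gamma>]]
      rr_bracket_apply[OF trilinear_compose(2)[OF \<gamma>]]
      rr_bracket_apply[OF trilinear_compose(3)[OF \<gamma>]] sum.distrib[symmetric]
  \<comment> \<open>Summands are compared after adding those with \<open>i\<close> and
    \<open>j\<close> exchanged.\<close>
  proof (rule double_sum_symmetrized_eqI, goal_cases)
    case (1 i j)
    \<comment> \<open>Products with \<open>x\<close> outermost come only from \<open>Q(x)\<close>.
      Jacobi is instantiated at these, in both index orders because of the symmetrisation;
      commutativity then matches the remaining terms.\<close>
    note J = m_jacobi[of x "a i" "a j"] m_jacobi[of x "a j" "a i"]
      m_jacobi[of x "b i" "b j"] m_jacobi[of x "b j" "b i"]
      m_jacobi[of x "b i" "a j"] m_jacobi[of x "b j" "a i"]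
    show ?case
      unfolding I_def J trilinear_map_neg_diff[OF \<gamma>]
      by (simp add: m_commute)
  qed
  also have "\<dots> = 0"
    by (simp add: sum.distrib sum_subtractf)
  finally show ?thesis
    by (simp add: eq_neg_iff_add_eq_0)
qed

lemma tensor_Q_eq_0_iff:
  assumes "\<And>x. tensor_flip s (\<Delta> x) = \<Delta> x"
  shows "tensor_Q s m x (rr_bracket s m r) = 0 \<longleftrightarrow>
    (\<forall>\<gamma>. trilinear_map s (*) \<gamma> \<longrightarrow> cyclic_\<Delta> x \<gamma> = 0)" (is "?L \<longleftrightarrow> ?R")
proof
  assume ?L
  then show ?R
    by (simp add: cyclic_\<Delta>_eq_Q[OF assms])
next
  assume R: ?R
  show ?L
  proof
    fix \<gamma>
    show "tensor_Q s m x (rr_bracket s m r) \<gamma> = 0 \<gamma>"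
    proof (cases "trilinear_map s (*) \<gamma>")
      case True
      then show ?thesis
        using R cyclic_\<Delta>_eq_Q[OF assms True, of x] by simp
    \<comment> \<open>Off the trilinear forms \<open>tensor_Q\<close> is 0 by definition.\<close>
    qed (simp add: tensor_Q_def tensor_map3_def)
  qed
qed

section \<open>The equivalence and the bialgebra structure\<close>

lemma dual_mock_lie_iff_conditions:
  assumes "\<And>\<xi> \<eta>. \<xi> \<in> dual_space s \<Longrightarrow> \<eta> \<in> dual_space s \<Longrightarrow> dia \<xi> \<eta> = dual_product \<Delta> \<xi> \<eta>"
  shows "mock_lie_algebra fun_scale (dual_space s) dia \<longleftrightarrow>
    (\<forall>x. tensor_L_minus s m x (r + tensor_flip s r) = 0 \<and> tensor_Q s m x (rr_bracket s m r) = 0)"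
proof -
  have "mock_lie_algebra fun_scale (dual_space s) dia \<longleftrightarrow>
    (\<forall>x. tensor_flip s (\<Delta> x) = \<Delta> x) \<and> (\<forall>x \<gamma>. trilinear_map s (*) \<gamma> \<longrightarrow> cyclic_\<Delta> x \<gamma> = 0)"
    using dual_mock_lie_iff[of dia] assms dual_product_commute_iff dual_product_jacobi_iff by simp
  then show ?thesis
    unfolding flip_\<Delta>_iff[symmetric]
    \<comment> \<open>Jacobi translates into condition (ii) under condition (i); if (i) fails, both
      sides are false.\<close>
    by (cases "\<forall>x. tensor_flip s (\<Delta> x) = \<Delta> x") (auto simp: tensor_Q_eq_0_iff)
qed

lemma coboundary_bialgebra:
  assumes "\<forall>x. tensor_L_minus s m x (r + tensor_flip s r) = 0 \<and>
    tensor_Q s m x (rr_bracket s m r) = 0"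
  shows "coboundary_mock_lie_bialgebra s m \<Delta>"
proof -
  \<comment> \<open>The equivalence with \<open>dia\<close> taken to be
    \<open>dual_product \<Delta>\<close> itself.\<close>
  have "mock_lie_algebra fun_scale (dual_space s) (dual_product \<Delta>)"
    using assms dual_mock_lie_iff_conditions by blast
  moreover have "tensor_flip s \<circ> \<Delta> = \<Delta>"
    using assms by (simp add: fun_eq_iff[where f = "_ \<circ> _"] flip_\<Delta>_iff)
  moreover have "r \<in> tensor_space s"
    unfolding tensor_space_eq_sums[OF vector_space_axioms] using r_sum by blast
  ultimately show ?thesis
    unfolding coboundary_mock_lie_bialgebra_def mock_lie_bialgebra_def
    using mock_lie_algebra_axioms linear_\<Delta> \<Delta>_in_tensor_space \<Delta>_mult by blast
qed

end

theorem theorem4p4: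
  fixes s :: "'k::field_char_0 \<Rightarrow> 'a::ab_group_add \<Rightarrow> 'a"
    and m :: "'a \<Rightarrow> 'a \<Rightarrow> 'a"
    and r :: "('k, 'a) tens2"
    and \<Delta> :: "'a \<Rightarrow> ('k, 'a) tens2"
    and dia :: "('a \<Rightarrow> 'k) \<Rightarrow> ('a \<Rightarrow> 'k) \<Rightarrow> ('a \<Rightarrow> 'k)"
  assumes "mock_lie_algebra s UNIV m"
    and "r \<in> tensor_space s"
    and "\<And>x. \<Delta> x = tensor_L_minus s m x r"
    and "\<And>\<xi> \<eta> x. \<xi> \<in> dual_space s \<Longrightarrow> \<eta> \<in> dual_space s \<Longrightarrow>
          dia \<xi> \<eta> x = tensor_pairing \<xi> \<eta> (\<Delta> x)"
  shows "(mock_lie_algebra fun_scale (dual_space s) dia \<longleftrightarrow>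
           (\<forall>x. tensor_L_minus s m x (r + tensor_flip s r) = 0 \<and>
                tensor_Q s m x (rr_bracket s m r) = 0)) \<and>
         ((\<forall>x. tensor_L_minus s m x (r + tensor_flip s r) = 0 \<and>
               tensor_Q s m x (rr_bracket s m r) = 0) \<longrightarrow>
           coboundary_mock_lie_bialgebra s m \<Delta>)"
proof -
  \<comment> \<open>The conclusion mentions only \<open>r\<close>, so any decomposition may
    instantiate the locale.\<close>
  obtain n :: nat and a b where "r = (\<Sum>i<n. tensor s (a i) (b i))"
    using assms(1,2) tensor_space_eq_sums[of s r] by (auto simp: mock_lie_algebra_def)
  with assms(1) interpret c: coboundary_comultiplication s m r n a b
    by (simp add: coboundary_comultiplication_def coboundary_comultiplication_axioms_def)
  have \<Delta>: "\<Delta> = c.\<Delta>"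
    using assms(3) by blast
  have "dia \<xi> \<eta> = dual_product c.\<Delta> \<xi> \<eta>" if "\<xi> \<in> dual_space s" "\<eta> \<in> dual_space s" for \<xi> \<eta>
    using assms(4)[OF that] by (simp add: fun_eq_iff dual_product_def \<Delta>)
  then show ?thesis
    using c.dual_mock_lie_iff_conditions c.coboundary_bialgebra unfolding \<Delta> by blast
qed

end
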